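(* Let $n\ge7$. Let $Q(A_n)=(q_{i,j})_{i,j=1}^n$ be defined by - $q_{i,j}=0$ for $j=1,\dots,n-2$ and $i\le n-j-1$; - $q_{n,1}=q_{1,n}=1$ and $q_{n-i,i}=1$ for $i=1,\dots,n-1$; - $q_{n,2}=q_{2,n}=2$ and $q_{n-i+1,i}=q_{n-i+1,i+1}=2$ for $i=2,\dots,n-1$; - $q_{n-j,i+1}=i+1-j$ for $j=0,\dots,n-2$ and $i=j+2,\dots,n-1$; and let $Q(B_n)=Q(A_n)-D$, where $D=(d_{i,j})_{i,j=1}^n$ is given by - $d_{n-i-1,i}=-1$ for $i=1,\dots,n-2$; - $d_{n-i,i}=-1$ for $i=2,\dots,n-2$; - $d_{n-i+1,i+1}=-1$ for $i=2,\dots,n-2$; - $d_{n-i+1,i+2}=-1$ for $i=2,\dots,n-3$; - $d_{i,j}=0$ otherwise. Then the (self-dual) discrete imprecise copula $(Q(A_n),Q(B_n))$ avoids sure loss and is coherent.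
   Context: Let $L_n=\{0,1,\dots,n\}$. A matrix $(q_{r,s})_{r,s=1}^n$ is identified with the function $Q:L_n^2\to\mathbb R$, $Q(r,s)=q_{r,s}$ for $r,s\ge1$ and $Q(r,0)=Q(0,s)=0$. A function $C:L_n^2\to[0,n]$ is a discrete copula if $C(r,0)=C(0,s)=0$, $C(r,n)=r$, $C(n,s)=s$ for all $r,s\in L_n$, and $C(r_1,s_1)+C(r_2,s_2)\ge C(r_1,s_2)+C(r_2,s_1)$ whenever $r_1\le r_2$, $s_1\le s_2$ in $L_n$. It is known that $(Q(A_n),Q(B_n))$ is a self-dual discrete imprecise copula (in particular both are discrete quasi-copulas on $L_n^2$ and $Q(A_n)\le Q(B_n)$). For a discrete imprecise copula $(P,Q)$ let $\mathcal C(P,Q)$ be the set of all discrete copulas $C$ on $L_n^2$ with $P\le C\le Q$ pointwise. $(P,Q)$ avoids sure loss if $\mathcal C(P,Q)\neq\emptyset$; it is coherent if it avoids sure loss and $P(r,s)=\inf_{C\in\mathcal C(P,Q)}C(r,s)$ and $Q(r,s)=\sup_{C\in\mathcal C(P,Q)}C(r,s)$ for all $r,s\in L_n$. *)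

theory Defs
  imports Complex_Main
begin

text \<open>
  With \<open>L\<^sub>n = {0, \<dots>, n}\<close>, functions on \<open>L\<^sub>n \<times> L\<^sub>n\<close> are rendered as functions on
  \<open>nat \<times> nat\<close> of which only the values at arguments \<open>\<le> n\<close> are ever constrained or inspected.
\<close>

definition discrete_copula :: "nat \<Rightarrow> (nat \<Rightarrow> nat \<Rightarrow> real) \<Rightarrow> bool" where
  "discrete_copula n C \<longleftrightarrow>
     (\<forall>r\<le>n. \<forall>s\<le>n. C r s \<in> {0..real n}) \<and>
     (\<forall>r\<le>n. C r 0 = 0 \<and> C r n = real r) \<and>
     (\<forall>s\<le>n. C 0 s = 0 \<and> C n s = real s) \<and>
     (\<forall>r1 r2 s1 s2. r1 \<le> r2 \<and> r2 \<le> n \<and> s1 \<le> s2 \<and> s2 \<le> n \<longrightarrow>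
        C r1 s1 + C r2 s2 \<ge> C r1 s2 + C r2 s1)"

definition copulas_between ::
    "nat \<Rightarrow> (nat \<Rightarrow> nat \<Rightarrow> real) \<Rightarrow> (nat \<Rightarrow> nat \<Rightarrow> real) \<Rightarrow> (nat \<Rightarrow> nat \<Rightarrow> real) set" where
  "copulas_between n P Q =
     {C. discrete_copula n C \<and> (\<forall>r\<le>n. \<forall>s\<le>n. P r s \<le> C r s \<and> C r s \<le> Q r s)}"

definition avoids_sure_loss ::
    "nat \<Rightarrow> (nat \<Rightarrow> nat \<Rightarrow> real) \<Rightarrow> (nat \<Rightarrow> nat \<Rightarrow> real) \<Rightarrow> bool" where
  "avoids_sure_loss n P Q \<longleftrightarrow> copulas_between n P Q \<noteq> {}"

text \<open>
  The infima and suprema below are taken in the reals; they are genuine because the first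
  conjunct makes the set of copulas nonempty and copulas have values in \<open>[0, n]\<close>.
\<close>

definition coherent ::
    "nat \<Rightarrow> (nat \<Rightarrow> nat \<Rightarrow> real) \<Rightarrow> (nat \<Rightarrow> nat \<Rightarrow> real) \<Rightarrow> bool" where
  "coherent n P Q \<longleftrightarrow>
     avoids_sure_loss n P Q \<and>
     (\<forall>r\<le>n. \<forall>s\<le>n.
        P r s = (INF C \<in> copulas_between n P Q. C r s) \<and>
        Q r s = (SUP C \<in> copulas_between n P Q. C r s))"

text \<open>
  \<open>QA n\<close> is the function \<open>Q(A\<^sub>n)\<close>. The clauses of its definition never contradict one another and
  cover all indices in \<open>{1, \<dots>, n}\<close>, so that their order is immaterial and the last line only
  sets the values outside that range; see the lemmas after the definition.
\<close>

definition QA :: "nat \<Rightarrow> nat \<Rightarrow> nat \<Rightarrow> real" where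
  "QA n r s =
     (if s \<in> {1..n-2} \<and> 1 \<le> r \<and> r \<le> n - s - 1 then 0
      else if (r = n \<and> s = 1) \<or> (r = 1 \<and> s = n) \<or>
              (\<exists>i\<in>{1..n-1}. r = n - i \<and> s = i) then 1
      else if (r = n \<and> s = 2) \<or> (r = 2 \<and> s = n) \<or>
              (\<exists>i\<in>{2..n-1}. r = n - i + 1 \<and> (s = i \<or> s = i + 1)) then 2
      else if \<exists>j\<in>{0..n-2}. \<exists>i\<in>{j+2..n-1}. r = n - j \<and> s = i + 1 then
        real r + real s - real n
      else 0)"

lemma QA_zero:
  assumes "j \<in> {1..n-2}" "1 \<le> i" "i \<le> n - j - 1"
  shows "QA n i j = 0"
  using assms by (simp add: QA_def)

lemma QA_one:
  assumes "n \<ge> 7"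
  shows "QA n n 1 = 1" "QA n 1 n = 1" "i \<in> {1..n-1} \<Longrightarrow> QA n (n - i) i = 1"
  using assms by (auto simp: QA_def)

lemma QA_two:
  assumes "n \<ge> 7"
  shows "QA n n 2 = 2" "QA n 2 n = 2"
    "i \<in> {2..n-1} \<Longrightarrow> QA n (n - i + 1) i = 2"
    "i \<in> {2..n-1} \<Longrightarrow> QA n (n - i + 1) (i + 1) = 2"
proof -
  show "QA n n 2 = 2" "QA n 2 n = 2" using assms by (auto simp: QA_def)
next
  assume i: "i \<in> {2..n-1}"
  have "\<not> (n - i + 1 \<le> n - i - 1)" "\<not> (\<exists>k\<in>{1..n-1}. n - i + 1 = n - k \<and> i = k)"
    using i by auto
  moreover have "\<exists>k\<in>{2..n-1}. n - i + 1 = n - k + 1 \<and> (i = k \<or> i = k + 1)"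
    using i by blast
  moreover have "i \<noteq> 1" "i \<noteq> n" using i by auto
  ultimately show "QA n (n - i + 1) i = 2" unfolding QA_def by (simp only: if_False if_True simp_thms)
next
  assume i: "i \<in> {2..n-1}"
  have "\<not> (n - i + 1 \<le> n - (i + 1) - 1)"
    "\<not> (\<exists>k\<in>{1..n-1}. n - i + 1 = n - k \<and> i + 1 = k)"
    using i by auto
  moreover have "\<exists>k\<in>{2..n-1}. n - i + 1 = n - k + 1 \<and> (i + 1 = k \<or> i + 1 = k + 1)"
    using i by blast
  moreover have "i + 1 \<noteq> 1" "n - i + 1 \<noteq> 1" using i by auto
  ultimately show "QA n (n - i + 1) (i + 1) = 2" unfolding QA_def by (simp only: if_False if_True simp_thms)
qed

lemma QA_rest:
  assumes "n \<ge> 7" "j \<in> {0..n-2}" "i \<in> {j+2..n-1}"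
  shows "QA n (n - j) (i + 1) = real i + 1 - real j"
proof -
  have 1: "j \<le> n - 2" "j + 2 \<le> i" "i \<le> n - 1" using assms by auto
  have "\<not> (n - j \<le> n - (i+1) - 1)" using assms 1 by linarith
  moreover have "\<not> (\<exists>k\<in>{1..n-1}. n - j = n - k \<and> i + 1 = k)" using assms 1 by auto
  moreover have "\<not> (\<exists>k\<in>{2..n-1}. n - j = n - k + 1 \<and> (i + 1 = k \<or> i + 1 = k + 1))"
    using assms 1 by auto
  moreover have "\<exists>j'\<in>{0..n-2}. \<exists>i'\<in>{j'+2..n-1}. n - j = n - j' \<and> i + 1 = i' + 1"
    using assms by blast
  moreover have "\<not> (n - j = n \<and> i + 1 = 1)" "\<not> (n - j = 1 \<and> i + 1 = n)"
      "\<not> (n - j = n \<and> i + 1 = 2)" "\<not> (n - j = 2 \<and> i + 1 = n) \<or> i + 1 - j = 2"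
    using assms 1 by auto
  ultimately show ?thesis using assms 1 unfolding QA_def by (auto simp: of_nat_diff)
qed

lemma QA_boundary:
  assumes "n \<ge> 7"
  shows "QA n r 0 = 0" "QA n 0 s = 0"
  using assms by (auto simp: QA_def)

lemma QA_clauses_cover:
  fixes n r s :: nat
  assumes "r \<in> {1..n}" "s \<in> {1..n}"
  shows "(s \<in> {1..n-2} \<and> 1 \<le> r \<and> r \<le> n - s - 1) \<or>
    (r = n \<and> s = 1) \<or> (r = 1 \<and> s = n) \<or> (\<exists>i\<in>{1..n-1}. r = n - i \<and> s = i) \<or>
    (r = n \<and> s = 2) \<or> (r = 2 \<and> s = n) \<or>
    (\<exists>i\<in>{2..n-1}. r = n - i + 1 \<and> (s = i \<or> s = i + 1)) \<or>
    (\<exists>j\<in>{0..n-2}. \<exists>i\<in>{j+2..n-1}. r = n - j \<and> s = i + 1)"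
proof -
  consider "r + s < n" | "r + s = n" | "r + s = n + 1" | "r + s = n + 2" | "r + s > n + 2"
    by linarith
  then show ?thesis
  proof cases
    case 1
    then have "s \<in> {1..n-2} \<and> 1 \<le> r \<and> r \<le> n - s - 1" using assms by auto
    then show ?thesis by blast
  next
    case 2
    then have "s \<in> {1..n-1} \<and> r = n - s" using assms by auto
    then show ?thesis by blast
  next
    case 3
    then have "s = 1 \<and> r = n \<or> s = n \<and> r = 1 \<or> s \<in> {2..n-1} \<and> r = n - s + 1"
      using assms by auto
    then show ?thesis by blast
  next
    case 4
    then have "s = 2 \<and> r = n \<or> s = n \<and> r = 2 \<or>
        s - 1 \<in> {2..n-1} \<and> r = n - (s - 1) + 1 \<and> s = (s - 1) + 1"
      using assms by auto
    then show ?thesis by blast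
  next
    case 5
    then have "n - r \<in> {0..n-2} \<and> s - 1 \<in> {(n - r) + 2..n-1} \<and> r = n - (n - r) \<and> s = (s - 1) + 1"
      using assms by auto
    then show ?thesis by blast
  qed
qed

definition D :: "nat \<Rightarrow> nat \<Rightarrow> nat \<Rightarrow> real" where
  "D n r s =
     (if (\<exists>i\<in>{1..n-2}. r = n - i - 1 \<and> s = i) \<or>
         (\<exists>i\<in>{2..n-2}. r = n - i \<and> s = i) \<or>
         (\<exists>i\<in>{2..n-2}. r = n - i + 1 \<and> s = i + 1) \<or>
         (\<exists>i\<in>{2..n-3}. r = n - i + 1 \<and> s = i + 2)
      then -1 else 0)"

definition QB :: "nat \<Rightarrow> nat \<Rightarrow> nat \<Rightarrow> real" where
  "QB n r s = QA n r s - D n r s"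

end

theory Submission
  imports Defs
begin

text \<open>
  Put \<open>t = r + s - n\<close>. Both bounds have the shape \<open>min r (min s (f t))\<close>, where \<open>f\<close> agrees for the
  two bounds outside \<open>t \<in> {-1, 0, 2, 3}\<close> and differs by one there. Copulas of this shape do not
  suffice: a convex \<open>f\<close> between the two bounds is forced to be linear from \<open>(-2, 0)\<close> through
  \<open>(1, 2)\<close> to \<open>(4, 4)\<close>, so it attains neither bound on the critical antidiagonals. But there one may
  alternate between the two bounds with period 3 in \<open>r\<close>, and this gives a copula with integer
  values. Its three shifts attain both bounds at every point.
\<close>

definition lower_profile :: "int \<Rightarrow> int" where
  "lower_profile t = (if t \<le> -1 then 0 else if t = 0 then 1 else if t \<le> 2 then 2 else t)"

definition upper_profile :: "int \<Rightarrow> int" where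
  "upper_profile t =
     (if t \<le> -2 then 0 else if t = -1 then 1 else if t \<le> 1 then 2
      else if t = 2 then 3 else if t = 3 then 4 else t)"

text \<open>Residue 0 of \<open>m\<close> yields \<open>lower_profile\<close> and residue 2 yields
  \<open>upper_profile\<close>; residue 1 is a transition, raised only at \<open>t = -1\<close> and
  \<open>t = 2\<close>.\<close>

definition periodic_profile :: "nat \<Rightarrow> int \<Rightarrow> int" where
  "periodic_profile m t =
     (if (t = -1 \<or> t = 2) \<and> m mod 3 \<noteq> 0 \<or> (t = 0 \<or> t = 3) \<and> m mod 3 = 2
      then upper_profile t else lower_profile t)"

definition truncate_profile :: "nat \<Rightarrow> (int \<Rightarrow> int) \<Rightarrow> nat \<Rightarrow> nat \<Rightarrow> int" where
  "truncate_profile n f r s = min (min (int r) (int s)) (f (int r + int s - int n))"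

definition periodic_copula :: "nat \<Rightarrow> nat \<Rightarrow> nat \<Rightarrow> nat \<Rightarrow> real" where
  "periodic_copula n d r s = real_of_int (truncate_profile n (periodic_profile (r + d)) r s)"

text \<open>Every clause of \<open>QA\<close> is governed by the antidiagonal of the point, so the
  cases follow \<open>r + s\<close>. On the grid, the minimum with \<open>r\<close> and
  \<open>s\<close> matters only at \<open>(n, 0)\<close>, \<open>(0, n)\<close>,
  \<open>(n, 1)\<close> and \<open>(1, n)\<close>.\<close>

lemma QA_eq_truncate_profile:
  assumes "n \<ge> 7" "r \<le> n" "s \<le> n"
  shows "QA n r s = real_of_int (truncate_profile n lower_profile r s)"
proof -
  consider "r = 0 \<or> s = 0" | "1 \<le> r" "1 \<le> s" "r + s < n" | "1 \<le> r" "1 \<le> s" "r + s = n"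
    | "1 \<le> r" "1 \<le> s" "r + s = n + 1" | "1 \<le> r" "1 \<le> s" "r + s = n + 2"
    | "1 \<le> r" "1 \<le> s" "r + s > n + 2"
    by linarith
  then show ?thesis
  proof cases
    case 1
    then show ?thesis
      using assms QA_boundary[OF assms(1)]
      by (auto simp: truncate_profile_def lower_profile_def)
  next
    case 2
    then have "QA n r s = 0" by (intro QA_zero) auto
    then show ?thesis using 2 by (simp add: truncate_profile_def lower_profile_def)
  next
    case 3
    then have "QA n r s = 1" using QA_one(3)[OF assms(1), of s] by auto
    then show ?thesis using 3 by (simp add: truncate_profile_def lower_profile_def)
  next
    case 4
    then consider "r = n" "s = 1" | "r = 1" "s = n" | "2 \<le> s" "s \<le> n - 1" "r = n - s + 1"
      using assms by linarith
    then show ?thesis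
      using QA_one[OF assms(1)] QA_two(3)[OF assms(1), of s] 4 assms
      by cases (auto simp: truncate_profile_def lower_profile_def)
  next
    case 5
    then consider "r = n" "s = 2" | "r = 2" "s = n" | "3 \<le> s" "s \<le> n - 1" "r = n - (s - 1) + 1"
      using assms by linarith
    then have "QA n r s = 2"
    proof cases
      case 3
      then have "s - 1 \<in> {2..n-1}" "s - 1 + 1 = s" by auto
      then show ?thesis using QA_two(4)[OF assms(1), of "s - 1"] 3(3) by metis
    qed (use QA_two[OF assms(1)] in auto)
    then show ?thesis using 5 assms by (auto simp: truncate_profile_def lower_profile_def)
  next
    case 6
    then have "n - r \<in> {0..n-2}" "s - 1 \<in> {n - r + 2..n-1}" using assms by auto
    then have "QA n r s = real r + real s - real n"
      using QA_rest[OF assms(1), of "n - r" "s - 1"] 6 assms by (simp add: of_nat_diff)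
    then show ?thesis
      using 6 assms by (simp add: truncate_profile_def lower_profile_def)
  qed
qed

text \<open>The side conditions remove from the four antidiagonals exactly the points where
  \<open>min r s\<close> already caps \<open>upper_profile\<close> at the value of
  \<open>QA\<close>.\<close>

lemma D_eq:
  assumes "n \<ge> 7" "r \<le> n" "s \<le> n"
  shows "D n r s =
    (if r + s = n - 1 \<and> 1 \<le> r \<and> 1 \<le> s \<or> r + s = n \<and> 2 \<le> r \<and> 2 \<le> s \<or>
        r + s = n + 2 \<and> r < n \<and> s < n \<or> r + s = n + 3 \<and> r < n \<and> s < n
     then -1 else 0)"
proof -
  have "(\<exists>i\<in>{1..n-2}. r = n - i - 1 \<and> s = i) \<longleftrightarrow> r + s = n - 1 \<and> 1 \<le> r \<and> 1 \<le> s"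
    "(\<exists>i\<in>{2..n-2}. r = n - i \<and> s = i) \<longleftrightarrow> r + s = n \<and> 2 \<le> r \<and> 2 \<le> s"
    using assms by auto
  moreover have "(\<exists>i\<in>{2..n-2}. r = n - i + 1 \<and> s = i + 1) \<longleftrightarrow> r + s = n + 2 \<and> r < n \<and> s < n"
    using assms by (auto intro!: bexI[of _ "s - 1"])
  moreover have "(\<exists>i\<in>{2..n-3}. r = n - i + 1 \<and> s = i + 2) \<longleftrightarrow> r + s = n + 3 \<and> r < n \<and> s < n"
    using assms by (auto intro!: bexI[of _ "s - 2"])
  ultimately show ?thesis unfolding D_def by simp
qed

lemma QB_eq_truncate_profile:
  assumes "n \<ge> 7" "r \<le> n" "s \<le> n"
  shows "QB n r s = real_of_int (truncate_profile n upper_profile r s)"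
  using assms
  unfolding QB_def QA_eq_truncate_profile[OF assms] D_eq[OF assms] truncate_profile_def
    lower_profile_def upper_profile_def
  by (auto simp: min_def)

lemma truncate_profile_mono:
  assumes "\<And>t. f t \<le> g t"
  shows "truncate_profile n f r s \<le> truncate_profile n g r s"
  using assms unfolding truncate_profile_def by (intro min.mono) auto

lemma lower_le_upper_profile: "lower_profile t \<le> upper_profile t"
  by (simp add: lower_profile_def upper_profile_def)

lemma lower_le_periodic_profile: "lower_profile t \<le> periodic_profile m t"
  by (simp add: periodic_profile_def lower_le_upper_profile)

lemma periodic_le_upper_profile: "periodic_profile m t \<le> upper_profile t"
  by (simp add: periodic_profile_def lower_le_upper_profile)

text \<open>Before truncation, every step of a row from \<open>s\<close> to \<open>s + 1\<close> is
  0 or 1. For \<open>t\<close> from -2 to 3 it is 0 iff \<open>t\<close> is congruent to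
  \<open>r + d + 1\<close> mod 3, that is, iff \<open>s\<close> is congruent to
  \<open>n + d + 1\<close>, whatever the row. So the steps in rows \<open>r\<close> and
  \<open>r + 1\<close> cancel, except that to the left of this range row \<open>r\<close> has step 0
  and to its right row \<open>r + 1\<close> has step 1; both give nonnegative mass. Truncation is
  covered by the case split.\<close>

lemma periodic_copula_cell:
  "periodic_copula n d r (Suc s) + periodic_copula n d (Suc r) s
     \<le> periodic_copula n d r s + periodic_copula n d (Suc r) (Suc s)"
proof -
  define t where "t = int r + int s - int n"
  have m: "Suc r + d = Suc (r + d)" by simp
  have "truncate_profile n (periodic_profile (r + d)) r (Suc s)
      + truncate_profile n (periodic_profile (Suc (r + d))) (Suc r) s
    \<le> truncate_profile n (periodic_profile (r + d)) r s
      + truncate_profile n (periodic_profile (Suc (r + d))) (Suc r) (Suc s)"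
  proof -
    have t: "int r + int s - int n = t" "int r + int (Suc s) - int n = t + 1"
      "int (Suc r) + int s - int n = t + 1" "int (Suc r) + int (Suc s) - int n = t + 2"
      by (auto simp: t_def)
    \<comment> \<open>A cell involves only \<open>t\<close>, \<open>t + 1\<close> and
      \<open>t + 2\<close>; in the two extreme cases the profile is 0, respectively the identity, at
      all three.\<close>
    consider "t \<le> -4" | "t = -3" | "t = -2" | "t = -1" | "t = 0" | "t = 1" | "t = 2" | "t = 3" | "t \<ge> 4"
      by linarith
    moreover have "(r + d) mod 3 = 0 \<and> Suc (r + d) mod 3 = 1 \<or>
      (r + d) mod 3 = 1 \<and> Suc (r + d) mod 3 = 2 \<or> (r + d) mod 3 = 2 \<and> Suc (r + d) mod 3 = 0"
      by presburger
    ultimately show ?thesis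
      unfolding truncate_profile_def t periodic_profile_def lower_profile_def upper_profile_def
      by cases (elim disjE conjE; simp add: min_def)+
  qed
  then show ?thesis
    unfolding periodic_copula_def m by linarith
qed

text \<open>Cells telescope first along \<open>s\<close>, then along \<open>r\<close>. They are
  assumed on all of \<open>nat\<close>, without a grid bound, so that
  \<open>lift_Suc_mono_le\<close> applies directly.\<close>

lemma supermodular_if_cells:
  fixes f :: "nat \<Rightarrow> nat \<Rightarrow> real"
  assumes cell: "\<And>r s. f r (Suc s) + f (Suc r) s \<le> f r s + f (Suc r) (Suc s)"
    and "r1 \<le> r2" "s1 \<le> s2"
  shows "f r1 s2 + f r2 s1 \<le> f r1 s1 + f r2 s2"
proof -
  have row: "f r s2 - f r s1 \<le> f (Suc r) s2 - f (Suc r) s1" for r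
  proof -
    have "f (Suc r) s - f r s \<le> f (Suc r) (Suc s) - f r (Suc s)" for s
      using cell[of r s] by linarith
    then have "f (Suc r) s1 - f r s1 \<le> f (Suc r) s2 - f r s2"
      using \<open>s1 \<le> s2\<close> by (rule lift_Suc_mono_le[where f = "\<lambda>s. f (Suc r) s - f r s"])
    then show ?thesis by linarith
  qed
  have "f r1 s2 - f r1 s1 \<le> f r2 s2 - f r2 s1"
    using row \<open>r1 \<le> r2\<close> by (rule lift_Suc_mono_le[where f = "\<lambda>r. f r s2 - f r s1"])
  then show ?thesis by linarith
qed

lemma discrete_copula_periodic: "discrete_copula n (periodic_copula n d)"
proof -
  have low: "lower_profile t \<ge> max 0 t" for t
    by (simp add: lower_profile_def)
  \<comment> \<open>The first bound gives the zero margins. The second gives the margins at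
    \<open>n\<close>, where \<open>t\<close> equals the other coordinate.\<close>
  have ge: "periodic_profile m t \<ge> 0" "periodic_profile m t \<ge> t" for m t
    using low[of t] lower_le_periodic_profile[of t m] by linarith+
  have "0 \<le> truncate_profile n (periodic_profile m) r s" for m r s
    using ge by (simp add: truncate_profile_def)
  moreover have "truncate_profile n f r s \<le> int r" for f r s
    by (simp add: truncate_profile_def)
  ultimately have "periodic_copula n d r s \<in> {0..real n}" if "r \<le> n" for r s
    unfolding periodic_copula_def using that
    by (smt (verit) atLeastAtMost_iff of_int_0_le_iff of_int_le_iff of_int_of_nat_eq of_nat_mono)
  moreover have "periodic_copula n d r 0 = 0" "periodic_copula n d 0 r = 0" for r
    using ge(1) by (simp_all add: periodic_copula_def truncate_profile_def min_absorb1)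
  moreover have "periodic_copula n d r n = real r" "periodic_copula n d n r = real r"
    if "r \<le> n" for r
    using that ge(2) by (simp_all add: periodic_copula_def truncate_profile_def min_absorb1 min_absorb2)
  ultimately show ?thesis
    unfolding discrete_copula_def
    by (auto intro: supermodular_if_cells periodic_copula_cell)
qed

lemma periodic_copula_between:
  assumes "n \<ge> 7"
  shows "periodic_copula n d \<in> copulas_between n (QA n) (QB n)"
  using discrete_copula_periodic assms
  by (auto simp: copulas_between_def QA_eq_truncate_profile QB_eq_truncate_profile
      periodic_copula_def lower_le_periodic_profile periodic_le_upper_profile
      intro!: truncate_profile_mono)

lemma shift_to_residue: "\<exists>d. (r + d) mod 3 = m mod (3::nat)"
  \<comment> \<open>With this witness \<open>r + d = 3 * r + m\<close>.\<close>
  by (rule exI[of _ "2 * r + m"]) presburger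

lemma periodic_copula_attains_QA:
  assumes "n \<ge> 7" "r \<le> n" "s \<le> n"
  shows "\<exists>d. periodic_copula n d r s = QA n r s"
proof -
  \<comment> \<open>The residue fixes the profile of the whole row, so the shift can be chosen from
    \<open>r\<close> alone.\<close>
  obtain d where "(r + d) mod 3 = 0" using shift_to_residue[of r 0] by force
  then have "periodic_profile (r + d) = lower_profile"
    by (auto simp: periodic_profile_def)
  then show ?thesis
    using QA_eq_truncate_profile[OF assms] by (intro exI[of _ d]) (simp add: periodic_copula_def)
qed

lemma periodic_copula_attains_QB:
  assumes "n \<ge> 7" "r \<le> n" "s \<le> n"
  shows "\<exists>d. periodic_copula n d r s = QB n r s"
proof -
  obtain d where "(r + d) mod 3 = 2" using shift_to_residue[of r 2] by force
  then have "periodic_profile (r + d) = upper_profile"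
    by (auto simp: periodic_profile_def lower_profile_def upper_profile_def)
  then show ?thesis
    using QB_eq_truncate_profile[OF assms] by (intro exI[of _ d]) (simp add: periodic_copula_def)
qed

theorem mainTheorem6:
  fixes n :: nat
  assumes "n \<ge> 7"
  shows "avoids_sure_loss n (QA n) (QB n) \<and> coherent n (QA n) (QB n)"
proof -
  let ?S = "copulas_between n (QA n) (QB n)"
  have loss: "avoids_sure_loss n (QA n) (QB n)"
    using periodic_copula_between[OF assms] by (auto simp: avoids_sure_loss_def)
  have "QA n r s = (INF C\<in>?S. C r s) \<and> QB n r s = (SUP C\<in>?S. C r s)"
    if "r \<le> n" "s \<le> n" for r s
  proof
    \<comment> \<open>Attainment turns the infimum into a minimum, and likewise the supremum into a
      maximum below.\<close>
    have "QA n r s \<in> (\<lambda>C. C r s) ` ?S"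
      using periodic_copula_attains_QA[OF assms that] periodic_copula_between[OF assms]
      by (metis imageI)
    then show "QA n r s = (INF C\<in>?S. C r s)"
      using that by (intro cInf_eq_minimum[symmetric]) (auto simp: copulas_between_def)
    have "QB n r s \<in> (\<lambda>C. C r s) ` ?S"
      using periodic_copula_attains_QB[OF assms that] periodic_copula_between[OF assms]
      by (metis imageI)
    then show "QB n r s = (SUP C\<in>?S. C r s)"
      using that by (intro cSup_eq_maximum[symmetric]) (auto simp: copulas_between_def)
  qed
  then show ?thesis
    using loss by (simp add: coherent_def)
qed

end
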